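(* Let $n\ge 2$, let $a\in\mathbb{R}^n_{\ge 0}$ with $\prod_{i=1}^n a_i\ge 1$, and let $p^0\in \mathrm{sl}(n)\cap\mathbb{R}^n_{\ge 0}$. Let $(p^k)_{k\ge 0}$ be the sequence of iterates generated by the composite-step algorithm from $p^0$, and let $t^k\in\mathbb{R}$ be the corresponding step lengths. Then $$\lim_{k\to\infty}\bigl\| p^k-a+(-t^k)(p^k)^{-1}\bigr\|=0 .$$ In particular, any convergent subsequence of $(p^k,t^k)$ converges to a solution of the stationarity equations, with $-t^k$ converging to the multiplier $\lambda$: that is, if $(p^{k_j},-t^{k_j})\to(p,\lambda)$ along a subsequence, then $p-a+\lambda p^{-1}=0$ and $\prod_{i=1}^n p_i=1$.
   Context: $\mathbb{R}^n_{\ge 0}=\{x\in\mathbb{R}^n : x_i\ge 0 \text{ for all } i\}$ and $\mathrm{sl}(n)=\{x\in\mathbb{R}^n : \prod_{i=1}^n x_i=1\}$. For a vector $p$ with nonzero entries, $p^{-1}=(p_1^{-1},\dots,p_n^{-1})^T$ denotes the componentwise inverse. Composite-step algorithm: given $a\in\mathbb{R}^n_{\ge 0}$ and $p^0\in \mathrm{sl}(n)\cap\mathbb{R}^n_{\ge 0}$, for $k=0,1,2,\dots$ set $d^k=(p^k)^{-1}$ (a normal vector to $\mathrm{sl}(n)$ at $p^k$), let $t^k$ be the unique real number such that $a+t^kd^k\in \mathrm{sl}(n)\cap\mathbb{R}^n_{\ge 0}$, and set $p^{k+1}=a+t^kd^k$. *)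

theory Defs
  imports "HOL-Analysis.Analysis"
begin

definition nonneg_orthant :: "(real ^ 'n) set" where
  "nonneg_orthant = {x. \<forall>i. 0 \<le> x $ i}"

definition sl :: "(real ^ 'n) set" where
  "sl = {x. (\<Prod>i\<in>UNIV. x $ i) = 1}"

definition cinv :: "real ^ 'n \<Rightarrow> real ^ 'n" where
  "cinv p = (\<chi> i. inverse (p $ i))"

text \<open>The description is proper whenever \<open>a \<in> nonneg_orthant\<close> and
  \<open>p \<in> sl \<inter> nonneg_orthant\<close>: then all entries of \<open>cinv p\<close> are positive, and the product of
  the entries of \<open>a + t *\<^sub>R cinv p\<close> increases strictly from \<open>0\<close> to infinity along the ray of
  those \<open>t\<close> for which this vector is nonnegative.\<close>

definition step_length :: "real ^ 'n \<Rightarrow> real ^ 'n \<Rightarrow> real" where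
  "step_length a p = (THE t. a + t *\<^sub>R cinv p \<in> sl \<inter> nonneg_orthant)"

primrec iterates :: "real ^ 'n \<Rightarrow> real ^ 'n \<Rightarrow> nat \<Rightarrow> real ^ 'n" where
  "iterates a p0 0 = p0"
| "iterates a p0 (Suc k) =
     a + step_length a (iterates a p0 k) *\<^sub>R cinv (iterates a p0 k)"

end

theory Submission imports Defs begin

text \<open>Let \<open>p'\<close> be the iterate after \<open>p\<close>, with step length \<open>t\<close>. Since \<open>\<Prod>i. a\<^sub>i \<ge> 1\<close>, we have
  \<open>t \<le> 0\<close>. The set \<open>{x. \<Prod>i. x\<^sub>i \<ge> 1}\<close> lies above its tangent hyperplane at \<open>p\<close> (AM-GM), so
  \<open>(p' - p) \<bullet> p\<^sup>-\<^sup>1 \<ge> 0\<close>, hence \<open>(p' - p) \<bullet> (p' - a) \<le> 0\<close> because \<open>p' - a = t p\<^sup>-\<^sup>1\<close>. Expanding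
  \<open>\<parallel>p - a\<parallel>\<^sup>2\<close> gives \<open>\<parallel>p - p'\<parallel>\<^sup>2 \<le> \<parallel>p - a\<parallel>\<^sup>2 - \<parallel>p' - a\<parallel>\<^sup>2\<close>. The right-hand side telescopes, and
  \<open>p - p'\<close> is exactly the stationarity residual \<open>p - a - t p\<^sup>-\<^sup>1\<close>.\<close>

lemma prod_UNIV_nonzeroD:
  fixes f :: "'a::finite \<Rightarrow> 'b::comm_semiring_1"
  assumes "prod f UNIV \<noteq> 0"
  shows "f i \<noteq> 0"
  using assms by (meson UNIV_I finite prod_zero)

lemma sl_nonneg_orthant_pos:
  assumes "x \<in> sl \<inter> nonneg_orthant"
  shows "0 < x $ i"
proof -
  have "x $ i \<noteq> 0"
    using assms by (intro prod_UNIV_nonzeroD[where f = "($) x"]) (simp add: sl_def)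
  moreover have "0 \<le> x $ i"
    using assms by (simp add: nonneg_orthant_def)
  ultimately show ?thesis by simp
qed

text \<open>Serves both the uniqueness of the step length and its sign. Positivity at
  \<open>s\<close> keeps the other factors from annihilating a strict increase.\<close>

lemma prod_ray_strict_mono:
  fixes a d :: "real ^ 'n"
  assumes "\<And>i. 0 < d $ i" and "\<And>i. 0 < (a + s *\<^sub>R d) $ i" and "s < t"
  shows "(\<Prod>i\<in>UNIV. (a + s *\<^sub>R d) $ i) < (\<Prod>i\<in>UNIV. (a + t *\<^sub>R d) $ i)"
proof (rule prod_mono_strict)
  show "0 \<le> (a + s *\<^sub>R d) $ i \<and> (a + s *\<^sub>R d) $ i \<le> (a + t *\<^sub>R d) $ i" for i
    using assms(1)[of i] assms(2)[of i] \<open>s < t\<close> by (simp add: mult_right_mono)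
  show "0 < (a + t *\<^sub>R d) $ i" for i
  proof -
    have "s * d $ i < t * d $ i"
      using assms(1)[of i] \<open>s < t\<close> by simp
    then show ?thesis
      using assms(2)[of i] by simp
  qed
  \<comment> \<open>One strictly increasing factor suffices; \<open>undefined\<close> is just some
    index of the nonempty type \<open>'n\<close>.\<close>
  show "(a + s *\<^sub>R d) $ undefined < (a + t *\<^sub>R d) $ undefined"
    using assms(1)[of undefined] \<open>s < t\<close> by simp
qed auto

text \<open>Makes the \<open>THE\<close> in \<open>step_length\<close> meaningful. Existence is the
  intermediate value theorem between the point where the line leaves the orthant (product 0) and
  \<open>a\<close> itself (product at least 1).\<close>

lemma ex1_sl_on_ray:
  fixes a d :: "real ^ 'n"
  assumes "a \<in> nonneg_orthant" and "(\<Prod>i\<in>UNIV. a $ i) \<ge> 1" and d: "\<And>i. 0 < d $ i"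
  shows "\<exists>!t. a + t *\<^sub>R d \<in> sl \<inter> nonneg_orthant"
proof (rule ex_ex1I)
  let ?f = "\<lambda>t. \<Prod>i\<in>UNIV. (a + t *\<^sub>R d) $ i"
  \<comment> \<open>Going backwards from \<open>a\<close>, the first coordinate to vanish does so at
    parameter \<open>- m\<close>; for all \<open>t \<ge> - m\<close> the point stays in the
    orthant.\<close>
  define m where "m = Min (range (\<lambda>i. a $ i / d $ i))"
  have m_le: "m \<le> a $ i / d $ i" for i
    by (simp add: m_def)
  have "m \<in> range (\<lambda>i. a $ i / d $ i)"
    unfolding m_def by (rule Min_in) auto
  then obtain j where j: "m = a $ j / d $ j"
    by auto
  have "0 \<le> m"
    using assms(1) d[of j] by (simp add: j nonneg_orthant_def)
  have "(a + (- m) *\<^sub>R d) $ j = 0"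
    using d[of j] by (simp add: j)
  then have "?f (- m) \<le> 1"
    by (metis prod_UNIV_nonzeroD zero_le_one)
  moreover have "1 \<le> ?f 0"
    using assms(2) by simp
  moreover have "continuous_on {- m..0} ?f"
    by (intro continuous_intros)
  ultimately obtain t where t: "- m \<le> t" "?f t = 1"
    using IVT'[of ?f "- m" 1 0] \<open>0 \<le> m\<close> by (metis neg_le_0_iff_le)
  have "0 \<le> (a + t *\<^sub>R d) $ i" for i
  proof -
    have "- t \<le> a $ i / d $ i"
      using m_le[of i] t(1) by simp
    then have "- t * d $ i \<le> a $ i"
      using d[of i] by (simp add: pos_le_divide_eq)
    then show ?thesis by simp
  qed
  with t(2) show "\<exists>t. a + t *\<^sub>R d \<in> sl \<inter> nonneg_orthant"
    by (auto simp: sl_def nonneg_orthant_def)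
next
  \<comment> \<open>Both products equal 1, whereas \<open>s < t\<close> would make the second
    strictly larger.\<close>
  have not_less: "\<not> s < t"
    if "a + s *\<^sub>R d \<in> sl \<inter> nonneg_orthant" "a + t *\<^sub>R d \<in> sl \<inter> nonneg_orthant" for s t
    using prod_ray_strict_mono[of d a s t] d sl_nonneg_orthant_pos[OF that(1)] that
    by (auto simp: sl_def)
  show "s = t"
    if "a + s *\<^sub>R d \<in> sl \<inter> nonneg_orthant" "a + t *\<^sub>R d \<in> sl \<inter> nonneg_orthant" for s t
    using not_less[OF that] not_less[OF that(2) that(1)] by simp
qed

lemma step_length_in_sl:
  assumes "a \<in> nonneg_orthant" and "(\<Prod>i\<in>UNIV. a $ i) \<ge> 1" and "x \<in> sl \<inter> nonneg_orthant"
  shows "a + step_length a x *\<^sub>R cinv x \<in> sl \<inter> nonneg_orthant"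
  unfolding step_length_def
  by (rule theI'[OF ex1_sl_on_ray[OF assms(1,2)]])
    (simp add: cinv_def sl_nonneg_orthant_pos[OF assms(3)])

text \<open>A positive step from \<open>a\<close> along a positive direction would push the product
  strictly above 1.\<close>

lemma step_length_nonpos:
  fixes a x :: "real ^ 'n"
  assumes "a \<in> nonneg_orthant" and "(\<Prod>i\<in>UNIV. a $ i) \<ge> 1" and "x \<in> sl \<inter> nonneg_orthant"
  shows "step_length a x \<le> 0"
proof (rule ccontr)
  assume "\<not> step_length a x \<le> 0"
  moreover have "0 < a $ i" for i
  proof -
    have "a $ i \<noteq> 0"
      using assms(2) by (intro prod_UNIV_nonzeroD[where f = "($) a"]) linarith
    moreover have "0 \<le> a $ i"
      using assms(1) by (simp add: nonneg_orthant_def)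
    ultimately show ?thesis by simp
  qed
  moreover have "0 < cinv x $ i" for i
    by (simp add: cinv_def sl_nonneg_orthant_pos[OF assms(3)])
  ultimately have
    "(\<Prod>i\<in>UNIV. a $ i) < (\<Prod>i\<in>UNIV. (a + step_length a x *\<^sub>R cinv x) $ i)"
    using prod_ray_strict_mono[of "cinv x" a 0 "step_length a x"] by simp
  with assms(2) step_length_in_sl[OF assms] show False
    by (simp add: sl_def)
qed

text \<open>AM-GM in logarithmic form: the inner product is the sum of
  \<open>y $ i / x $ i - 1\<close>, and \<open>ln u \<le> u - 1\<close> bounds it below by the
  logarithm of a quotient of products, \<open>ln 1 = 0\<close>.\<close>

lemma sl_above_tangent:
  fixes x y :: "real ^ 'n"
  assumes x: "x \<in> sl \<inter> nonneg_orthant" and y: "y \<in> sl \<inter> nonneg_orthant"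
  shows "0 \<le> (y - x) \<bullet> cinv x"
proof -
  have pos: "0 < y $ i / x $ i" for i
    by (simp add: sl_nonneg_orthant_pos[OF x] sl_nonneg_orthant_pos[OF y])
  have "(\<Sum>i\<in>UNIV. ln (y $ i / x $ i)) = ln (\<Prod>i\<in>UNIV. y $ i / x $ i)"
    by (rule ln_prod[symmetric]) (simp, metis pos less_irrefl)
  also have "\<dots> = 0"
    using x y by (simp add: prod_dividef sl_def)
  finally have "0 \<le> (\<Sum>i\<in>UNIV. y $ i / x $ i - 1)"
    using sum_mono[of UNIV "\<lambda>i. ln (y $ i / x $ i)" "\<lambda>i. y $ i / x $ i - 1"]
      ln_le_minus_one[OF pos] by simp
  also have "\<dots> = (\<Sum>i\<in>UNIV. (y $ i - x $ i) * inverse (x $ i))"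
  proof (rule sum.cong[OF refl])
    show "y $ i / x $ i - 1 = (y $ i - x $ i) * inverse (x $ i)" for i
      using sl_nonneg_orthant_pos[OF x, of i] by (simp add: field_simps)
  qed
  also have "\<dots> = (y - x) \<bullet> cinv x"
    by (simp add: inner_vec_def cinv_def)
  finally show ?thesis .
qed

lemma step_descent:
  fixes a x :: "real ^ 'n"
  defines "y \<equiv> a + step_length a x *\<^sub>R cinv x"
  assumes "a \<in> nonneg_orthant" and "(\<Prod>i\<in>UNIV. a $ i) \<ge> 1" and "x \<in> sl \<inter> nonneg_orthant"
  shows "(norm (x - y))\<^sup>2 \<le> (norm (x - a))\<^sup>2 - (norm (y - a))\<^sup>2"
proof -
  have "y - a = step_length a x *\<^sub>R cinv x"
    by (simp add: y_def)
  then have "(y - x) \<bullet> (y - a) = step_length a x * ((y - x) \<bullet> cinv x)"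
    by simp
  moreover have "0 \<le> (y - x) \<bullet> cinv x"
    unfolding y_def by (intro sl_above_tangent step_length_in_sl assms)
  ultimately have "(y - x) \<bullet> (y - a) \<le> 0"
    using step_length_nonpos[OF assms(2-4)] by (simp add: mult_nonpos_nonneg)
  \<comment> \<open>Law of cosines in the triangle \<open>x\<close>, \<open>y\<close>,
    \<open>a\<close>, whose angle at \<open>y\<close> is not acute by the previous
    inequality.\<close>
  moreover have "(norm (x - a))\<^sup>2 =
      (norm (x - y))\<^sup>2 + (norm (y - a))\<^sup>2 - 2 * ((y - x) \<bullet> (y - a))"
    by (simp add: power2_norm_eq_inner inner_diff_left inner_diff_right inner_commute)
  ultimately show ?thesis by simp
qed

text \<open>The partial sums telescope to at most \<open>g 0 - g n\<close>, and \<open>g n\<close>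
  is nonnegative.\<close>

lemma summable_telescope_bound:
  fixes f g :: "nat \<Rightarrow> real"
  assumes "\<And>k. 0 \<le> f k" and "\<And>k. 0 \<le> g k" and "\<And>k. f k \<le> g k - g (Suc k)"
  shows "summable f"
proof (rule summableI_nonneg_bounded)
  show "(\<Sum>k<n. f k) \<le> g 0" for n
  proof -
    have "(\<Sum>k<n. f k) \<le> (\<Sum>k<n. g k - g (Suc k))"
      by (intro sum_mono assms)
    also have "\<dots> = g 0 - g n"
      by (rule sum_lessThan_telescope')
    finally show ?thesis
      using assms(2)[of n] by simp
  qed
qed (rule assms)

lemma iterates_in_sl:
  assumes "a \<in> nonneg_orthant" and "(\<Prod>i\<in>UNIV. a $ i) \<ge> 1" and "p0 \<in> sl \<inter> nonneg_orthant"
  shows "iterates a p0 k \<in> sl \<inter> nonneg_orthant"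
proof (induction k)
  case 0
  show ?case using assms(3) by simp
next
  case (Suc k)
  show ?case using step_length_in_sl[OF assms(1,2) Suc.IH] by simp
qed

lemma tendsto_cinv:
  fixes x :: "'b \<Rightarrow> real ^ 'n"
  assumes "(x \<longlongrightarrow> q) F" and "\<And>i. q $ i \<noteq> 0"
  shows "((\<lambda>k. cinv (x k)) \<longlongrightarrow> cinv q) F"
  unfolding cinv_def by (intro tendsto_intros assms)

theorem theorem5p5:
  fixes a p0 :: "real ^ 'n"
    and p :: "nat \<Rightarrow> real ^ 'n"
    and t :: "nat \<Rightarrow> real"
  assumes "CARD('n) \<ge> 2"
    and "a \<in> nonneg_orthant"
    and "(\<Prod>i\<in>UNIV. a $ i) \<ge> 1"
    and "p0 \<in> sl \<inter> nonneg_orthant"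
    and "p = iterates a p0"
    and "t = (\<lambda>k. step_length a (p k))"
  shows "(\<lambda>k. norm (p k - a + (- t k) *\<^sub>R cinv (p k))) \<longlonglongrightarrow> 0
    \<and> (\<forall>r q \<mu>. strict_mono r \<and> (\<lambda>j. (p (r j), - t (r j))) \<longlonglongrightarrow> (q, \<mu>)
          \<longrightarrow> q - a + \<mu> *\<^sub>R cinv q = 0 \<and> (\<Prod>i\<in>UNIV. q $ i) = 1)"
proof (intro conjI allI impI; (elim conjE)?)
  have p_in: "p k \<in> sl \<inter> nonneg_orthant" for k
    using iterates_in_sl[OF assms(2-4)] assms(5) by simp
  have p_Suc: "p (Suc k) = a + step_length a (p k) *\<^sub>R cinv (p k)" for k
    by (simp add: assms(5))
  have "(norm (p k - p (Suc k)))\<^sup>2 \<le> (norm (p k - a))\<^sup>2 - (norm (p (Suc k) - a))\<^sup>2" for k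
    using step_descent[OF assms(2,3) p_in] by (simp add: p_Suc)
  then have "summable (\<lambda>k. (norm (p k - p (Suc k)))\<^sup>2)"
    by (intro summable_telescope_bound[where g = "\<lambda>k. (norm (p k - a))\<^sup>2"]) auto
  then have "(\<lambda>k. (norm (p k - p (Suc k)))\<^sup>2) \<longlonglongrightarrow> 0"
    by (rule summable_LIMSEQ_zero)
  then have "(\<lambda>k. norm (p k - p (Suc k))) \<longlonglongrightarrow> 0"
    using tendsto_real_sqrt by fastforce
  then show residual: "(\<lambda>k. norm (p k - a + (- t k) *\<^sub>R cinv (p k))) \<longlonglongrightarrow> 0"
    by (simp add: p_Suc assms(6) algebra_simps)
  fix r :: "nat \<Rightarrow> nat" and q \<mu>
  assume r: "strict_mono r" and lim: "(\<lambda>j. (p (r j), - t (r j))) \<longlonglongrightarrow> (q, \<mu>)"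
  have p_lim: "(\<lambda>j. p (r j)) \<longlonglongrightarrow> q" and t_lim: "(\<lambda>j. - t (r j)) \<longlonglongrightarrow> \<mu>"
    using tendsto_fst[OF lim] tendsto_snd[OF lim] by simp_all
  have "(\<lambda>j. \<Prod>i\<in>UNIV. p (r j) $ i) \<longlonglongrightarrow> (\<Prod>i\<in>UNIV. q $ i)"
    by (intro tendsto_intros p_lim)
  moreover have "(\<Prod>i\<in>UNIV. p (r j) $ i) = 1" for j
    using p_in[of "r j"] by (simp add: sl_def)
  ultimately show prod_q: "(\<Prod>i\<in>UNIV. q $ i) = 1"
    by (simp add: LIMSEQ_const_iff)
  \<comment> \<open>The product constraint survives the limit, so \<open>q\<close> avoids the zeros
    where \<open>cinv\<close> is discontinuous. This is why feasibility of \<open>q\<close> comes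
    before stationarity.\<close>
  then have "q $ i \<noteq> 0" for i
    by (intro prod_UNIV_nonzeroD[where f = "($) q"]) simp
  then have "(\<lambda>j. norm (p (r j) - a + (- t (r j)) *\<^sub>R cinv (p (r j))))
      \<longlonglongrightarrow> norm (q - a + \<mu> *\<^sub>R cinv q)"
    by (intro tendsto_intros tendsto_cinv p_lim t_lim)
  moreover have "(\<lambda>j. norm (p (r j) - a + (- t (r j)) *\<^sub>R cinv (p (r j)))) \<longlonglongrightarrow> 0"
    using LIMSEQ_subseq_LIMSEQ[OF residual r] by (simp add: o_def)
  ultimately have "norm (q - a + \<mu> *\<^sub>R cinv q) = 0"
    by (rule LIMSEQ_unique)
  then show "q - a + \<mu> *\<^sub>R cinv q = 0"
    by simp
qed

end
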